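(* For any two-dimensional (real) normed space $(V,\|\cdot\|)$ and any independent identically distributed random vectors $X$ and $Y$ in $V$, $$\mathsf{E}\|X-Y\|\le\mathsf{E}\|X+Y\|.$$
   Context: $\mathsf{E}$ denotes expectation. All vector spaces are over $\mathbb{R}$. *)

theory Defs
  imports "HOL-Probability.Probability"
begin

end

theory Submission
  imports Defs
begin

text \<open>
For real random variables the inequality follows from distribution functions: if \<open>F\<close> and \<open>G\<close> belong
to \<open>U\<close> and \<open>- U\<close>, then \<open>E \<bar>U + V\<bar> - E \<bar>U - V\<bar>\<close> is formally the integral of \<open>(F - G)\<^sup>2\<close>
(\<open>nn_integral_abs_diff_le_abs_sum_iid\<close>). It therefore holds for every norm that is a finite sum
of absolute values of linear functionals, because a linear image of an i.i.d. pair is again i.i.d.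

In dimension two such norms approximate every norm within a factor \<open>1 + e\<close>
(\<open>two_dim_almost_isometric_l1_coordinates\<close>). Geometrically, the given norm is replaced by the one that
agrees with it on \<open>n\<close> equidistributed lines through the origin and is linear on the sectors between
them. Its only kinks are along these lines; each kink is convex, and it can be produced by a
nonnegative multiple of the absolute value of a functional vanishing on that line. The sizes of the
kinks are second differences of the norm along the unit circle, and a summation by parts shows that
these multiples add up exactly to the interpolating norm. Letting \<open>e\<close> tend to 0 concludes the proof.
\<close>

section \<open>Independent identically distributed real random variables\<close>

text \<open>Writing \<open>\<bar>a - b\<bar>\<close> as the length of the set of thresholds separating \<open>a\<close> from \<open>b\<close> turns
an expected distance into an integral of probabilities, which is where independence enters.\<close>

lemma ennreal_abs_diff_eq_nn_integral:
  fixes a b :: real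
  shows "ennreal \<bar>a - b\<bar> =
    (\<integral>\<^sup>+ t. indicator {t. a \<le> t \<and> t < b} t + indicator {t. b \<le> t \<and> t < a} t \<partial>lborel)"
proof -
  have eq: "{t. c \<le> t \<and> t < d} = {c..<d}" for c d :: real
    by auto
  show ?thesis
    unfolding eq by (subst nn_integral_add) (auto simp: abs_if)
qed

text \<open>By Tonelli, \<open>E \<bar>U - V\<bar>\<close> is the integral over \<open>t\<close> of the probability that \<open>t\<close> separates \<open>U\<close> from
\<open>V\<close>; independence factorises that probability. Both sides may be infinite.\<close>

lemma (in prob_space) nn_integral_abs_diff_indep:
  fixes U V :: "'a \<Rightarrow> real"
  assumes indep: "indep_var borel U borel V"
  shows "(\<integral>\<^sup>+ \<omega>. ennreal \<bar>U \<omega> - V \<omega>\<bar> \<partial>M) =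
    (\<integral>\<^sup>+ t. ennreal (cdf (distr M borel U) t * (1 - cdf (distr M borel V) t) +
                   cdf (distr M borel V) t * (1 - cdf (distr M borel U) t)) \<partial>lborel)"
proof -
  have [measurable]: "U \<in> borel_measurable M" "V \<in> borel_measurable M"
    using indep_var_rv1[OF indep] indep_var_rv2[OF indep] by auto
  interpret L: pair_sigma_finite M lborel ..
  define F where "F = cdf (distr M borel U)"
  define G where "G = cdf (distr M borel V)"
  have F: "F t = prob {\<omega> \<in> space M. U \<omega> \<le> t}" and G: "G t = prob {\<omega> \<in> space M. V \<omega> \<le> t}" for t
    unfolding F_def G_def cdf_def2
    by (auto simp: measure_distr vimage_def Int_def intro!: arg_cong[where f=prob])
  have F': "prob {\<omega> \<in> space M. t < U \<omega>} = 1 - F t" and G': "prob {\<omega> \<in> space M. t < V \<omega>} = 1 - G t" for t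
    unfolding F G by (subst prob_neg[symmetric]; simp add: not_le)+
  have prod: "prob {\<omega> \<in> space M. U \<omega> \<in> A \<and> V \<omega> \<in> B} =
      prob {\<omega> \<in> space M. U \<omega> \<in> A} * prob {\<omega> \<in> space M. V \<omega> \<in> B}"
    if "A \<in> sets borel" "B \<in> sets borel" for A B
    using indep_varD[OF indep that] by (simp add: vimage_def Int_def conj_commute)
  have UV: "prob {\<omega> \<in> space M. U \<omega> \<le> t \<and> t < V \<omega>} = F t * (1 - G t)"
   and VU: "prob {\<omega> \<in> space M. V \<omega> \<le> t \<and> t < U \<omega>} = G t * (1 - F t)" for t
    using prod[of "{..t}" "{t<..}"] prod[of "{t<..}" "{..t}"]
    unfolding F'[symmetric] G'[symmetric] by (simp_all add: F G conj_commute mult.commute)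
  have "(\<integral>\<^sup>+ \<omega>. ennreal \<bar>U \<omega> - V \<omega>\<bar> \<partial>M) =
    (\<integral>\<^sup>+ \<omega>. \<integral>\<^sup>+ t. indicator {t. U \<omega> \<le> t \<and> t < V \<omega>} t + indicator {t. V \<omega> \<le> t \<and> t < U \<omega>} t \<partial>lborel \<partial>M)"
    by (simp only: ennreal_abs_diff_eq_nn_integral)
  also have "\<dots> =
    (\<integral>\<^sup>+ t. \<integral>\<^sup>+ \<omega>. indicator {t. U \<omega> \<le> t \<and> t < V \<omega>} t + indicator {t. V \<omega> \<le> t \<and> t < U \<omega>} t \<partial>M \<partial>lborel)"
    by (rule L.Fubini'[symmetric]) (simp add: indicator_def of_bool_def, measurable)
  also have "\<dots> = (\<integral>\<^sup>+ t. ennreal (F t * (1 - G t) + G t * (1 - F t)) \<partial>lborel)"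
  proof (rule nn_integral_cong)
    fix t
    have "(\<integral>\<^sup>+ \<omega>. indicator {t. U \<omega> \<le> t \<and> t < V \<omega>} t + indicator {t. V \<omega> \<le> t \<and> t < U \<omega>} t \<partial>M)
      = (\<integral>\<^sup>+ \<omega>. indicator {\<omega> \<in> space M. U \<omega> \<le> t \<and> t < V \<omega>} \<omega>
            + indicator {\<omega> \<in> space M. V \<omega> \<le> t \<and> t < U \<omega>} \<omega> \<partial>M)"
      by (intro nn_integral_cong) (auto simp: indicator_def)
    also have "\<dots> = emeasure M {\<omega> \<in> space M. U \<omega> \<le> t \<and> t < V \<omega>}
        + emeasure M {\<omega> \<in> space M. V \<omega> \<le> t \<and> t < U \<omega>}"
      by (subst nn_integral_add) auto
    also have "\<dots> = ennreal (F t * (1 - G t)) + ennreal (G t * (1 - F t))"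
      by (simp add: emeasure_eq_measure UV VU)
    also have "\<dots> = ennreal (F t * (1 - G t) + G t * (1 - F t))"
      by (intro ennreal_plus[symmetric]) (simp_all flip: UV VU)
    finally show "(\<integral>\<^sup>+ \<omega>. indicator {t. U \<omega> \<le> t \<and> t < V \<omega>} t + indicator {t. V \<omega> \<le> t \<and> t < U \<omega>} t \<partial>M)
      = ennreal (F t * (1 - G t) + G t * (1 - F t))" .
  qed
  finally show ?thesis
    by (simp add: F_def G_def)
qed

text \<open>Let \<open>F\<close> and \<open>G\<close> be the distribution functions of \<open>U\<close> and \<open>- U\<close>. The preceding formula applies to
\<open>U - V\<close>, to \<open>(- U) - (- V)\<close>, which has the same absolute value, and to \<open>U + V = U - (- V)\<close>. The first two
together have integrand \<open>2 F (1 - F) + 2 G (1 - G)\<close>, twice the third has \<open>2 F (1 - G) + 2 G (1 - F)\<close>, and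
the difference is \<open>2 (F - G)\<^sup>2\<close>. Comparing integrands covers infinite expectations as well.\<close>

lemma (in prob_space) nn_integral_abs_diff_le_abs_sum_iid:
  fixes U V :: "'a \<Rightarrow> real"
  assumes indep: "indep_var borel U borel V" and ident: "distr M borel U = distr M borel V"
  shows "(\<integral>\<^sup>+ \<omega>. ennreal \<bar>U \<omega> - V \<omega>\<bar> \<partial>M) \<le> (\<integral>\<^sup>+ \<omega>. ennreal \<bar>U \<omega> + V \<omega>\<bar> \<partial>M)"
proof -
  have [measurable]: "U \<in> borel_measurable M" "V \<in> borel_measurable M"
    using indep_var_rv1[OF indep] indep_var_rv2[OF indep] by auto
  define F where "F = cdf (distr M borel U)"
  define G where "G = cdf (distr M borel (\<lambda>\<omega>. - U \<omega>))"
  have ident': "distr M borel (\<lambda>\<omega>. - U \<omega>) = distr M borel (\<lambda>\<omega>. - V \<omega>)"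
    using arg_cong[OF ident, of "\<lambda>N. distr N borel uminus"] by (simp add: distr_distr comp_def)
  have i1: "indep_var borel U borel (\<lambda>\<omega>. - V \<omega>)"
    using indep_var_compose[OF indep, of "\<lambda>x. x" borel uminus borel] by (simp add: comp_def)
  have i2: "indep_var borel (\<lambda>\<omega>. - U \<omega>) borel (\<lambda>\<omega>. - V \<omega>)"
    using indep_var_compose[OF indep, of uminus borel uminus borel] by (simp add: comp_def)
  define D where "D = (\<integral>\<^sup>+ \<omega>. ennreal \<bar>U \<omega> - V \<omega>\<bar> \<partial>M)"
  define S where "S = (\<integral>\<^sup>+ \<omega>. ennreal \<bar>U \<omega> + V \<omega>\<bar> \<partial>M)"
  have FG[measurable]: "F \<in> borel_measurable borel" "G \<in> borel_measurable borel"
    unfolding F_def G_def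
    by (auto intro!: borel_measurable_mono monoI finite_borel_measure.cdf_nondecreasing
        real_distribution.finite_borel_measure_M real_distribution_distr)
  have bound: "0 \<le> F t" "F t \<le> 1" "0 \<le> G t" "G t \<le> 1" for t
    unfolding F_def G_def cdf_def
    by (auto intro!: prob_space.prob_le_1 prob_space_distr)
  have D1: "D = (\<integral>\<^sup>+ t. ennreal (2 * (F t * (1 - F t))) \<partial>lborel)"
    unfolding D_def nn_integral_abs_diff_indep[OF indep] ident[symmetric] F_def[symmetric]
    by (simp add: algebra_simps)
  have "D = (\<integral>\<^sup>+ \<omega>. ennreal \<bar>- U \<omega> - (- V \<omega>)\<bar> \<partial>M)"
    unfolding D_def by (intro nn_integral_cong) (simp add: abs_minus_commute)
  then have D2: "D = (\<integral>\<^sup>+ t. ennreal (2 * (G t * (1 - G t))) \<partial>lborel)"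
    unfolding nn_integral_abs_diff_indep[OF i2] ident'[symmetric] G_def[symmetric]
    by (simp add: algebra_simps)
  have S: "S = (\<integral>\<^sup>+ t. ennreal (F t * (1 - G t) + G t * (1 - F t)) \<partial>lborel)"
    using nn_integral_abs_diff_indep[OF i1]
    by (simp add: S_def F_def G_def ident')
  have "2 * D = D + D" by (simp add: mult_2)
  also have "\<dots> = (\<integral>\<^sup>+ t. ennreal (2 * (F t * (1 - F t))) \<partial>lborel)
      + (\<integral>\<^sup>+ t. ennreal (2 * (G t * (1 - G t))) \<partial>lborel)"
    using D1 D2 by simp
  also have "\<dots> = (\<integral>\<^sup>+ t. ennreal (2 * (F t * (1 - F t))) + ennreal (2 * (G t * (1 - G t))) \<partial>lborel)"
    by (subst nn_integral_add) auto
  also have "\<dots> \<le> (\<integral>\<^sup>+ t. 2 * ennreal (F t * (1 - G t) + G t * (1 - F t)) \<partial>lborel)"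
  proof (rule nn_integral_mono)
    fix t
    have "2 * (F t * (1 - F t)) + 2 * (G t * (1 - G t)) \<le> 2 * (F t * (1 - G t) + G t * (1 - F t))"
      using zero_le_power2[of "F t - G t"] by (simp add: power2_eq_square algebra_simps)
    then have "ennreal (2 * (F t * (1 - F t)) + 2 * (G t * (1 - G t)))
        \<le> ennreal (2 * (F t * (1 - G t) + G t * (1 - F t)))"
      by (rule ennreal_leI)
    also have "\<dots> = 2 * ennreal (F t * (1 - G t) + G t * (1 - F t))"
      by (simp add: ennreal_mult' bound)
    finally show "ennreal (2 * (F t * (1 - F t))) + ennreal (2 * (G t * (1 - G t)))
        \<le> 2 * ennreal (F t * (1 - G t) + G t * (1 - F t))"
      using bound[of t] by (simp add: ennreal_plus)
  qed
  also have "\<dots> = 2 * S"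
    unfolding S by (subst nn_integral_cmult) auto
  finally show ?thesis
    by (simp add: ennreal_mult_le_mult_iff D_def S_def)
qed

section \<open>Interpolation by absolute values of sines\<close>

lemma periodic_sum_shift:
  fixes h :: "real \<Rightarrow> real"
  assumes per: "\<And>t. h (t + real n * d) = h t"
  shows "(\<Sum>k<n. h (t + real m * d + real k * d)) = (\<Sum>k<n. h (t + real k * d))"
proof (induction m)
  case (Suc m)
  define g where "g k = h (t + real m * d + real k * d)" for k
  have "(\<Sum>k<n. h (t + real (Suc m) * d + real k * d)) = (\<Sum>k<n. g (Suc k))"
    by (simp add: g_def algebra_simps)
  also have "\<dots> = (\<Sum>k<n. g k) + (g n - g 0)"
    using sum_lessThan_telescope[of g n] by (simp add: sum_subtractf)
  also have "g n = g 0"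
    using per[of "t + real m * d"] by (simp add: g_def)
  finally show ?case
    using Suc by (simp add: g_def)
qed simp

lemma step_bounds:
  fixes d :: real
  assumes n: "real n * d = pi" "2 \<le> n"
  shows "0 < d" "d \<le> pi / 2"
proof -
  show "0 < d"
    using n pi_gt_zero by (metis of_nat_0_le_iff zero_less_mult_iff not_le)
  then have "2 * d \<le> real n * d"
    using n by (intro mult_right_mono) auto
  then show "d \<le> pi / 2"
    using n by simp
qed

text \<open>As a function of \<open>b\<close>, this is the second difference with step \<open>d\<close>, corrected by \<open>2 * cos d\<close> instead
of \<open>2\<close> so that it annihilates \<open>sin\<close> and \<open>cos\<close>, applied to \<open>\<bar>sin\<bar>\<close>. Since \<open>\<bar>sin\<bar>\<close> is a sine
between consecutive zeros, only the kinks of \<open>\<bar>sin\<bar>\<close> at the multiples of \<open>pi\<close> contribute.\<close>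

definition kink :: "real \<Rightarrow> real \<Rightarrow> real" where
  "kink d b = \<bar>sin (b - d)\<bar> + \<bar>sin (b + d)\<bar> - 2 * cos d * \<bar>sin b\<bar>"

lemma abs_sin_minus_pi [simp]: "\<bar>sin (x - pi)\<bar> = \<bar>sin x\<bar>"
  by (simp add: sin_diff)

lemma kink_periodic: "kink d (b - pi) = kink d b"
proof -
  have e: "b - pi - d = b - d - pi" "b - pi + d = b + d - pi" by auto
  show ?thesis unfolding kink_def e abs_sin_minus_pi ..
qed

lemma kink_minus [simp]: "kink d (- b) = kink d b"
proof -
  have e: "- b - d = - (b + d)" "- b + d = - (b - d)" by auto
  show ?thesis unfolding kink_def e sin_minus by simp
qed

lemma kink_near:
  assumes "0 \<le> b" "b \<le> d" "d \<le> pi / 2"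
  shows "kink d b = 2 * sin (d - b)"
proof -
  have "sin (d - b) \<ge> 0" "sin (b + d) \<ge> 0" "sin b \<ge> 0"
    using assms by (auto intro!: sin_ge_zero)
  moreover have "sin (b - d) = - sin (d - b)"
    by (metis minus_diff_eq sin_minus)
  ultimately show ?thesis
    by (simp add: kink_def) (simp add: sin_add sin_diff)
qed

lemma kink_far:
  assumes "d \<le> b" "b \<le> pi - d" "0 \<le> d"
  shows "kink d b = 0"
proof -
  have "sin (b - d) \<ge> 0" "sin (b + d) \<ge> 0" "sin b \<ge> 0"
    using assms by (auto intro!: sin_ge_zero)
  then show ?thesis
    by (simp add: kink_def) (simp add: sin_add sin_diff)
qed

text \<open>Both sums run over one full period, so summation by parts has no boundary terms and moves the
second difference from \<open>f\<close> to \<open>\<bar>sin\<bar>\<close>.\<close>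

lemma second_difference_sum_by_parts:
  fixes f :: "real \<Rightarrow> real"
  assumes per: "\<And>t. f (t + pi) = f t" and n: "real n * d = pi"
  shows "(\<Sum>k<n. \<bar>sin (x - real k * d)\<bar> * (f (real k * d - d) + f (real k * d + d) - 2 * cos d * f (real k * d)))
       = (\<Sum>k<n. f (real k * d) * kink d (x - real k * d))"
proof -
  have sinper: "\<bar>sin (y - (t + pi))\<bar> = \<bar>sin (y - t)\<bar>" for y t
    using abs_sin_minus_pi[of "y - t"] by (simp add: algebra_simps)
  have fper: "f (t + pi - d) = f (t - d)" "f (t + pi + d) = f (t + d)" for t
    using per[of "t - d"] per[of "t + d"] by (simp_all add: algebra_simps)
  define h1 where "h1 t = \<bar>sin (x - t)\<bar> * f (t - d)" for t
  define h2 where "h2 t = \<bar>sin (x - t + d)\<bar> * f t" for t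
  have shift: "(\<Sum>k<n. h (real k * d + d)) = (\<Sum>k<n. h (real k * d))"
    if "\<And>t. h (t + pi) = h t" for h :: "real \<Rightarrow> real"
    using periodic_sum_shift[of h n d 0 1] that n by (simp add: add.commute)
  have "(\<Sum>k<n. h1 (real k * d + d)) = (\<Sum>k<n. h1 (real k * d))"
    by (rule shift) (simp add: h1_def sinper fper)
  moreover have "(\<Sum>k<n. h2 (real k * d + d)) = (\<Sum>k<n. h2 (real k * d))"
    by (rule shift) (use sinper[of "x + d"] in \<open>simp add: h2_def per algebra_simps\<close>)
  ultimately show ?thesis
    by (simp add: h1_def h2_def kink_def algebra_simps sum.distrib sum_subtractf)
qed

text \<open>At the angle \<open>m * d + a\<close> only the two neighbouring nodes \<open>m * d\<close> and \<open>m * d + d\<close> can be closer than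
\<open>d\<close> modulo \<open>pi\<close>, so the localisation of \<^const>\<open>kink\<close> leaves just these two terms. Up to the factor
\<open>2 * sin d\<close> this is the interpolation of \<open>f\<close> that is exact for \<open>sin\<close> and \<open>cos\<close>.\<close>

lemma second_difference_sum_interpolates:
  fixes f :: "real \<Rightarrow> real"
  assumes per: "\<And>t. f (t + pi) = f t" and n: "real n * d = pi" "2 \<le> n"
    and a: "0 \<le> a" "a \<le> d"
  shows "(\<Sum>k<n. \<bar>sin (real m * d + a - real k * d)\<bar> *
             (f (real k * d - d) + f (real k * d + d) - 2 * cos d * f (real k * d)))
       = 2 * (sin (d - a) * f (real m * d) + sin a * f (real m * d + d))"
proof -
  define h where "h t = f t * kink d (real m * d + a - t)" for t
  note d = step_bounds[OF n]
  have h: "h (t + real n * d) = h t" for t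
    using kink_periodic[of d "real m * d + a - t"]
    unfolding h_def n(1) per by (simp add: diff_diff_eq)
  \<comment> \<open>Start the period at the node \<open>m * d\<close>, so that the two surviving terms have index 0 and 1.\<close>
  have "(\<Sum>k<n. h (real k * d)) = (\<Sum>k<n. h (real m * d + real k * d))"
    using periodic_sum_shift[of h n d 0 m, OF h] by simp
  also have "\<dots> = (\<Sum>k\<in>{0, 1}. h (real m * d + real k * d))"
  proof (rule sum.mono_neutral_right)
    show "\<forall>k\<in>{..<n} - {0, 1}. h (real m * d + real k * d) = 0"
    proof
      fix k assume k: "k \<in> {..<n} - {0, 1}"
      have "2 * d \<le> real k * d" using k d by (intro mult_right_mono) auto
      then have lo: "d \<le> real k * d - a" using a by linarith
      have "(real k + 1) * d \<le> real n * d" using k d by (intro mult_right_mono) auto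
      then have hi: "real k * d - a \<le> pi - d" unfolding n(1) distrib_right using a by linarith
      have "kink d (real k * d - a) = 0"
        using kink_far[OF lo hi] d by simp
      then show "h (real m * d + real k * d) = 0"
        using kink_minus[of d "real k * d - a"] by (simp add: h_def)
    qed
  qed (use n in auto)
  also have "\<dots> = f (real m * d) * kink d a + f (real m * d + d) * kink d (d - a)"
    using kink_minus[of d "d - a"] by (simp add: h_def)
  also have "\<dots> = 2 * (sin (d - a) * f (real m * d) + sin a * f (real m * d + d))"
    using kink_near[of a d] kink_near[of "d - a" d] a d by simp
  finally show ?thesis
    using second_difference_sum_by_parts[of f n d "real m * d + a", OF per n(1)] by (simp add: h_def)
qed

section \<open>Approximating planar norms by sums of absolute values of functionals\<close>

lemma interpolation_weights_le:
  assumes "0 \<le> a" "a \<le> d" "d \<le> pi"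
  shows "0 \<le> sin (d - a)" "0 \<le> sin a" "sin (d - a) + sin a \<le> d"
  using assms sin_x_le_x[of a] sin_x_le_x[of "d - a"] by (auto intro!: sin_ge_zero)

text \<open>The coordinates of a direction with respect to two neighbouring nodes are, up to the
factor \<open>1 / sin d\<close>, the weights \<open>sin (d - a)\<close> and \<open>sin a\<close> above. Hence the interpolant of a norm is linear between neighbouring nodes, and it lies
above the norm by the triangle inequality.\<close>

lemma cis_between:
  "of_real (sin d) * cis (t + a) = of_real (sin (d - a)) * cis t + of_real (sin a) * cis (t + d)"
proof -
  have "of_real (sin d) * cis a = of_real (sin (d - a)) + of_real (sin a) * cis d"
    by (simp add: complex_eq_iff sin_diff algebra_simps)
  then show ?thesis
    by (simp add: cis_mult[symmetric] algebra_simps)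
       (metis (no_types, lifting) distrib_left mult.left_commute)
qed

lemma norm_cis_diff_le: "norm (cis s - cis t) \<le> \<bar>s - t\<bar>"
proof -
  have "cis s - cis t = cis t * (iexp (s - t) - 1)"
    by (simp only: cis_conv_exp[symmetric] right_diff_distrib cis_mult) simp
  then have "norm (cis s - cis t) = 2 * \<bar>sin ((s - t) / 2)\<bar>"
    using dist_exp_i_1[of "s - t"] by (simp add: norm_mult)
  also have "\<dots> \<le> 2 * \<bar>(s - t) / 2\<bar>"
    using abs_sin_x_le_abs_x[of "(s - t) / 2"] by linarith
  finally show ?thesis by simp
qed

text \<open>The values \<open>f t = norm (T (cis t))\<close> have nonnegative corrected second differences by
the triangle inequality, since \<open>cis (t - d) + cis (t + d) = 2 * cos d * cis t\<close>. They serve as the weights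
of the functionals \<open>z \<mapsto> Im (cis (- k * d) * z)\<close>, whose kernels are the node directions. The weighted sum
of the absolute values is then the function that agrees with \<open>z \<mapsto> norm (T z)\<close> on the lines through
the nodes and is linear on the sectors in between; the upper bound expresses that \<open>f\<close> has Lipschitz constant \<open>B\<close> and that the
interpolation weights add up to at most \<open>d / sin d\<close>.\<close>

lemma polygonal_norm_sandwich:
  fixes T :: "complex \<Rightarrow> 'a :: real_normed_vector"
  assumes T: "linear T" and B: "\<And>z. norm (T z) \<le> B * norm z"
    and n: "real n * d = pi" "2 \<le> n"
  obtains L :: "nat \<Rightarrow> complex \<Rightarrow> real"
  where "\<And>k. bounded_linear (L k)"
    and "\<And>z. norm (T z) \<le> (\<Sum>k<n. \<bar>L k z\<bar>)"
    and "\<And>z. (\<Sum>k<n. \<bar>L k z\<bar>) \<le> d / sin d * (norm (T z) + B * d * norm z)"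
proof -
  define f where "f t = norm (T (cis t))" for t
  define w where "w k = f (real k * d - d) + f (real k * d + d) - 2 * cos d * f (real k * d)" for k
  define L where "L k z = w k / (2 * sin d) * Im (cis (- (real k * d)) * z)" for k z
  note d = step_bounds[OF n]
  have sin_d: "sin d > 0" and cos_d: "cos d \<ge> 0"
    using d by (auto intro!: sin_gt_zero cos_ge_zero)
  have per: "f (t + pi) = f t" for t
    by (simp add: f_def cis_mult[symmetric] linear_neg[OF T])
  have scale: "norm (T (of_real r * z)) = \<bar>r\<bar> * norm (T z)" for r z
    using linear_scale[OF T, of r z] by (simp add: scaleR_conv_of_real)
  have w: "w k \<ge> 0" for k
  proof -
    have "cis (real k * d - d) + cis (real k * d + d) = of_real (2 * cos d) * cis (real k * d)"
      by (simp add: complex_eq_iff sin_add cos_add sin_diff cos_diff)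
    then have "2 * cos d * f (real k * d) = norm (T (cis (real k * d - d) + cis (real k * d + d)))"
      using scale[of "2 * cos d"] cos_d by (simp add: f_def)
    also have "\<dots> \<le> f (real k * d - d) + f (real k * d + d)"
      unfolding f_def linear_add[OF T] by (rule norm_triangle_ineq)
    finally show ?thesis by (simp add: w_def)
  qed
  have sandwich: "norm (T z) \<le> (\<Sum>k<n. \<bar>L k z\<bar>)
      \<and> (\<Sum>k<n. \<bar>L k z\<bar>) \<le> d / sin d * (norm (T z) + B * d * norm z)" for z
  proof -
    \<comment> \<open>\<open>t\<close> is the last node before the argument of \<open>z\<close>, and \<open>a\<close> the remaining angle.\<close>
    define r where "r = norm z"
    define m where "m = nat \<lfloor>Arg2pi z / d\<rfloor>"
    define t where "t = real m * d"
    define a where "a = Arg2pi z - t"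
    have m: "real m = \<lfloor>Arg2pi z / d\<rfloor>"
      using Arg2pi_ge_0[of z] d by (simp add: m_def)
    have "real m \<le> Arg2pi z / d" "Arg2pi z / d < real m + 1"
      unfolding m by linarith+
    then have a: "0 \<le> a" "a \<le> d"
      using d by (simp_all add: a_def t_def field_simps)
    have z: "z = of_real r * cis (t + a)"
      using Arg2pi_eq[of z] by (simp add: a_def r_def cis_conv_exp)
    have r: "r \<ge> 0" by (simp add: r_def)
    have Tz: "norm (T z) = r * f (t + a)"
      unfolding z scale f_def using r by simp
    have "(\<Sum>k<n. \<bar>L k z\<bar>) = (\<Sum>k<n. r / (2 * sin d) * (\<bar>sin (t + a - real k * d)\<bar> * w k))"
    proof (rule sum.cong[OF refl])
      fix k
      have "cis (- (real k * d)) * z = of_real r * cis (t + a - real k * d)"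
        by (simp add: z cis_mult mult.left_commute)
      then show "\<bar>L k z\<bar> = r / (2 * sin d) * (\<bar>sin (t + a - real k * d)\<bar> * w k)"
        using r w[of k] sin_d by (simp add: L_def abs_mult)
    qed
    also have "\<dots> = r / (2 * sin d) * (2 * (sin (d - a) * f t + sin a * f (t + d)))"
      unfolding sum_distrib_left[symmetric] w_def t_def
      by (subst second_difference_sum_interpolates[where f = f, OF per n a]) simp
    also have "\<dots> = r * ((sin (d - a) * f t + sin a * f (t + d)) / sin d)"
      using sin_d by (simp add: field_simps)
    finally have S: "(\<Sum>k<n. \<bar>L k z\<bar>) = r * ((sin (d - a) * f t + sin a * f (t + d)) / sin d)" .
    have wt: "0 \<le> sin (d - a)" "0 \<le> sin a" "sin (d - a) + sin a \<le> d"
      using interpolation_weights_le[OF a] d by auto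
    have "sin d * f (t + a) = norm (T (of_real (sin (d - a)) * cis t + of_real (sin a) * cis (t + d)))"
      unfolding cis_between[symmetric] scale f_def using sin_d by simp
    also have "\<dots> \<le> sin (d - a) * f t + sin a * f (t + d)"
      unfolding linear_add[OF T] using wt scale
      by (intro order_trans[OF norm_triangle_ineq]) (simp add: f_def)
    finally have lower: "f (t + a) \<le> (sin (d - a) * f t + sin a * f (t + d)) / sin d"
      using sin_d by (simp add: field_simps)
    have "B \<ge> 0" using B[of 1] norm_ge_zero[of "T 1"] by (simp del: norm_ge_zero)
    have near: "f s \<le> f (t + a) + B * d" if "\<bar>s - (t + a)\<bar> \<le> d" for s
    proof -
      have "f s - f (t + a) \<le> norm (T (cis s - cis (t + a)))"
        unfolding f_def linear_diff[OF T] by (rule norm_triangle_ineq2)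
      also have "\<dots> \<le> B * norm (cis s - cis (t + a))" by (rule B)
      also have "\<dots> \<le> B * d"
        using norm_cis_diff_le[of s "t + a"] that \<open>B \<ge> 0\<close> by (intro mult_left_mono) auto
      finally show ?thesis by simp
    qed
    define u where "u = f (t + a) + B * d"
    have "u \<ge> 0" using \<open>B \<ge> 0\<close> d by (simp add: u_def f_def)
    have "sin (d - a) * f t + sin a * f (t + d) \<le> sin (d - a) * u + sin a * u"
      unfolding u_def using wt a by (intro add_mono mult_left_mono near) auto
    also have "\<dots> = (sin (d - a) + sin a) * u" by (simp add: algebra_simps)
    also have "\<dots> \<le> d * u" using wt \<open>u \<ge> 0\<close> by (intro mult_right_mono) auto
    finally have upper: "(sin (d - a) * f t + sin a * f (t + d)) / sin d \<le> d * u / sin d"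
      using sin_d by (intro divide_right_mono) auto
    have u_eq: "d / sin d * (norm (T z) + B * d * norm z) = r * (d * u / sin d)"
      by (simp add: Tz u_def r_def[symmetric] algebra_simps add_divide_distrib)
    show ?thesis
    proof
      show "norm (T z) \<le> (\<Sum>k<n. \<bar>L k z\<bar>)"
        unfolding S Tz by (rule mult_left_mono[OF lower r])
      show "(\<Sum>k<n. \<bar>L k z\<bar>) \<le> d / sin d * (norm (T z) + B * d * norm z)"
        unfolding S u_eq by (rule mult_left_mono[OF upper r])
    qed
  qed
  have "bounded_linear (L k)" for k
    unfolding L_def
    by (intro bounded_linear_mult_right[THEN bounded_linear_compose]
        bounded_linear_Im[THEN bounded_linear_compose] bounded_linear_mult_right)
  with sandwich show ?thesis
    by (intro that[of L]) auto
qed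

text \<open>The additive error \<open>B * d * norm z\<close> becomes a relative one through the lower bound \<open>c\<close>, and the
resulting factor tends to 1 as the mesh \<open>d = pi / n\<close> shrinks.\<close>

lemma almost_isometric_l1_coordinates_complex:
  fixes T :: "complex \<Rightarrow> 'a :: real_normed_vector"
  assumes T: "linear T" and B: "\<And>z. norm (T z) \<le> B * norm z"
    and c: "c > 0" "\<And>z. c * norm z \<le> norm (T z)" and e: "e > 0"
  obtains n and L :: "nat \<Rightarrow> complex \<Rightarrow> real"
  where "\<And>k. bounded_linear (L k)"
    and "\<And>z. norm (T z) \<le> (\<Sum>k<n. \<bar>L k z\<bar>)"
    and "\<And>z. (\<Sum>k<n. \<bar>L k z\<bar>) \<le> (1 + e) * norm (T z)"
proof -
  define q where "q d = d / sin d * (1 + B * d / c)" for d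
  have "(q \<longlongrightarrow> 1) (at_right 0)"
  proof -
    have "((\<lambda>d. d / sin d) \<longlongrightarrow> (1::real)) (at_right 0)"
      by real_asymp
    then have "(q \<longlongrightarrow> 1 * (1 + B * 0 / c)) (at_right 0)"
      unfolding q_def using c(1) by (intro tendsto_intros) auto
    then show ?thesis by simp
  qed
  moreover have "filterlim (\<lambda>n. pi / real n) (at_right 0) sequentially"
    by real_asymp
  ultimately have "(\<lambda>n. q (pi / real n)) \<longlonglongrightarrow> 1"
    by (rule filterlim_compose)
  then have "\<forall>\<^sub>F n in sequentially. q (pi / real n) < 1 + e"
    using e by (intro order_tendstoD(2)) auto
  then have "\<forall>\<^sub>F n in sequentially. q (pi / real n) < 1 + e \<and> 2 \<le> n"
    using eventually_ge_at_top[of 2] by eventually_elim simp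
  then obtain n where n: "q (pi / real n) < 1 + e" "2 \<le> n"
    using eventually_happens trivial_limit_sequentially by blast
  define d where "d = pi / real n"
  have nd: "real n * d = pi" using n by (simp add: d_def)
  have d: "0 < d" "0 < sin d"
    using step_bounds[OF nd n(2)] by (auto intro: sin_gt_zero)
  have B0: "B \<ge> 0" using B[of 1] norm_ge_zero[of "T 1"] by (simp del: norm_ge_zero)
  obtain L :: "nat \<Rightarrow> complex \<Rightarrow> real" where L: "\<And>k. bounded_linear (L k)"
    "\<And>z. norm (T z) \<le> (\<Sum>k<n. \<bar>L k z\<bar>)"
    "\<And>z. (\<Sum>k<n. \<bar>L k z\<bar>) \<le> d / sin d * (norm (T z) + B * d * norm z)"
    using polygonal_norm_sandwich[OF T B nd n(2)] by blast
  have "(\<Sum>k<n. \<bar>L k z\<bar>) \<le> (1 + e) * norm (T z)" for z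
  proof -
    have "norm z \<le> norm (T z) / c" using c by (simp add: field_simps)
    then have "B * d * norm z \<le> B * d * (norm (T z) / c)"
      using B0 d by (intro mult_left_mono) auto
    then have "d / sin d * (norm (T z) + B * d * norm z) \<le> d / sin d * (norm (T z) + B * d * (norm (T z) / c))"
      using d by (intro mult_left_mono) auto
    also have "\<dots> = q d * norm (T z)" by (simp add: q_def algebra_simps)
    also have "\<dots> \<le> (1 + e) * norm (T z)" using n by (intro mult_right_mono) (auto simp: d_def)
    finally show ?thesis using L(3)[of z] by linarith
  qed
  with L that show ?thesis by blast
qed

text \<open>Identifying the space with the complex plane gives access to polar coordinates. The constant
\<open>c\<close> is the minimum of the norm over the compact unit circle, attained and nonzero by
injectivity; it makes the inverse coordinate map continuous.\<close>

lemma two_dim_coordinates: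
  assumes "dim (UNIV :: 'a::real_normed_vector set) = 2"
  obtains T :: "complex \<Rightarrow> 'a::real_normed_vector" and B c where "linear T" "bij T" "\<And>z. norm (T z) \<le> B * norm z"
    "c > 0" "\<And>z. c * norm z \<le> norm (T z)"
proof -
  obtain S :: "'a set" where S: "independent S" "UNIV \<subseteq> span S" "card S = 2"
    using real_vector.basis_exists[of UNIV] assms by metis
  then obtain b1 b2 where b: "S = {b1, b2}" "b1 \<noteq> b2"
    by (meson card_2_iff)
  define T where "T z = Re z *\<^sub>R b1 + Im z *\<^sub>R b2" for z
  have T: "linear T"
    by (rule linearI) (simp_all add: T_def algebra_simps)
  have inj: "inj T"
  proof (subst linear_injective_0[OF T], intro allI impI)
    fix z assume 0: "T z = 0"
    have "(\<Sum>v\<in>S. (if v = b1 then Re z else Im z) *\<^sub>R v) = 0"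
      using 0 b by (simp add: T_def)
    then have "\<forall>v\<in>S. (if v = b1 then Re z else Im z) = 0"
      using S(1) b independentD[of S S "\<lambda>v. if v = b1 then Re z else Im z"] by auto
    then show "z = 0"
      using b by (auto simp: complex_eq_iff)
  qed
  have "surj T"
    unfolding surj_def
  proof
    fix x
    have "x \<in> span {b1, b2}" using S b by auto
    then obtain p q where "x - p *\<^sub>R b1 = q *\<^sub>R b2"
      by (auto simp: span_insert span_singleton)
    then have "T (Complex p q) = x" by (simp add: T_def algebra_simps)
    then show "\<exists>z. x = T z" by blast
  qed
  define B where "B = norm b1 + norm b2"
  have B: "norm (T z) \<le> B * norm z" for z
  proof -
    have "norm (T z) \<le> \<bar>Re z\<bar> * norm b1 + \<bar>Im z\<bar> * norm b2"
      unfolding T_def by (rule order_trans[OF norm_triangle_ineq]) simp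
    also have "\<dots> \<le> norm z * norm b1 + norm z * norm b2"
      using abs_Re_le_cmod[of z] abs_Im_le_cmod[of z] by (intro add_mono mult_right_mono) auto
    finally show ?thesis by (simp add: B_def algebra_simps)
  qed
  have cont: "continuous_on (sphere 0 1) (\<lambda>z. norm (T z))"
    unfolding T_def by (intro continuous_intros)
  have "sphere (0::complex) 1 \<noteq> {}" by (auto intro: exI[of _ 1])
  then obtain z0 where z0: "z0 \<in> sphere 0 1" "\<And>z. z \<in> sphere 0 1 \<Longrightarrow> norm (T z0) \<le> norm (T z)"
    using continuous_attains_inf[OF compact_sphere _ cont] by blast
  have "T z0 \<noteq> 0"
    using inj z0(1) linear_0[OF T] by (metis injD norm_zero mem_sphere_0 zero_neq_one)
  have "norm (T z0) * norm z \<le> norm (T z)" for z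
  proof (cases "z = 0")
    case False
    have "norm (T z0) \<le> norm (T (z /\<^sub>R norm z))"
      using False by (intro z0) simp
    also have "\<dots> = norm (T z) / norm z"
      by (simp add: linear_scale[OF T] field_simps)
    finally show ?thesis using False by (simp add: field_simps)
  qed (simp add: linear_0[OF T])
  with T inj \<open>surj T\<close> B \<open>T z0 \<noteq> 0\<close> show ?thesis
    by (intro that[of T B "norm (T z0)"]) (auto simp: bij_def)
qed

text \<open>Dimension two enters here: planar norms are, up to \<open>1 + e\<close>, finite sums
of absolute values of linear functionals, whereas already in dimension three this fails for general norms.\<close>

lemma two_dim_almost_isometric_l1_coordinates:
  assumes dim2: "dim (UNIV :: 'a::real_normed_vector set) = 2" and e: "e > 0"
  obtains n and L :: "nat \<Rightarrow> 'a::real_normed_vector \<Rightarrow> real"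
  where "\<And>k. bounded_linear (L k)"
    and "\<And>x. norm x \<le> (\<Sum>k<n. \<bar>L k x\<bar>)"
    and "\<And>x. (\<Sum>k<n. \<bar>L k x\<bar>) \<le> (1 + e) * norm x"
proof -
  obtain T :: "complex \<Rightarrow> 'a" and B c where T: "linear T" "bij T"
    "\<And>z. norm (T z) \<le> B * norm z" "c > 0" "\<And>z. c * norm z \<le> norm (T z)"
    using two_dim_coordinates[OF dim2] by blast
  obtain n and L :: "nat \<Rightarrow> complex \<Rightarrow> real" where L: "\<And>k. bounded_linear (L k)"
    "\<And>z. norm (T z) \<le> (\<Sum>k<n. \<bar>L k z\<bar>)" "\<And>z. (\<Sum>k<n. \<bar>L k z\<bar>) \<le> (1 + e) * norm (T z)"
    using almost_isometric_l1_coordinates_complex[OF T(1,3,4,5) e] by metis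
  have TI: "T (inv T x) = x" for x
    using T(2) by (simp add: bij_is_surj surj_f_inv_f)
  have IT: "inv T (T z) = z" for z
    using T(2) by (simp add: bij_is_inj)
  have "bounded_linear (inv T)"
  proof (rule bounded_linear_intro)
    show "inv T (x + y) = inv T x + inv T y" for x y
      using IT[of "inv T x + inv T y"] by (simp add: linear_add[OF T(1)] TI)
    show "inv T (r *\<^sub>R x) = r *\<^sub>R inv T x" for r x
      using IT[of "r *\<^sub>R inv T x"] by (simp add: linear_scale[OF T(1)] TI)
    show "norm (inv T x) \<le> norm x * (1 / c)" for x
      using T(5)[of "inv T x"] T(4) by (simp add: TI field_simps)
  qed
  with L that[of "\<lambda>k x. L k (inv T x)" n] show ?thesis
    by (metis TI bounded_linear_compose)
qed

section \<open>The inequality for planar norms\<close>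

theorem corollary2p3:
  fixes M :: "'b measure" and X Y :: "'b \<Rightarrow> 'a::real_normed_vector"
  assumes dim2: "dim (UNIV :: 'a set) = 2"
    and prob: "prob_space M"
    and X: "X \<in> borel_measurable M"
    and Y: "Y \<in> borel_measurable M"
    and indep: "prob_space.indep_var M borel X borel Y"
    and ident: "distr M borel X = distr M borel Y"
  shows "(\<integral>\<^sup>+ \<omega>. ennreal (norm (X \<omega> - Y \<omega>)) \<partial>M)
           \<le> (\<integral>\<^sup>+ \<omega>. ennreal (norm (X \<omega> + Y \<omega>)) \<partial>M)"
    (is "?D \<le> ?S")
proof -
  interpret prob_space M by (rule prob)
  have approx: "?D \<le> ennreal (1 + e) * ?S" if e: "e > 0" for e :: real
  proof -
    obtain n and L :: "nat \<Rightarrow> 'a \<Rightarrow> real" where L: "\<And>k. bounded_linear (L k)"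
      and lower: "\<And>x. norm x \<le> (\<Sum>k<n. \<bar>L k x\<bar>)"
      and upper: "\<And>x. (\<Sum>k<n. \<bar>L k x\<bar>) \<le> (1 + e) * norm x"
      using two_dim_almost_isometric_l1_coordinates[OF dim2 e] by metis
    have L_meas: "L k \<in> borel_measurable borel" for k
      by (intro borel_measurable_continuous_onI linear_continuous_on L)
    have LX [measurable]: "(\<lambda>\<omega>. L k (X \<omega>)) \<in> borel_measurable M"
      and LY [measurable]: "(\<lambda>\<omega>. L k (Y \<omega>)) \<in> borel_measurable M" for k
      using measurable_compose[OF X L_meas] measurable_compose[OF Y L_meas] by auto
    have one_dim: "(\<integral>\<^sup>+ \<omega>. ennreal \<bar>L k (X \<omega>) - L k (Y \<omega>)\<bar> \<partial>M)
        \<le> (\<integral>\<^sup>+ \<omega>. ennreal \<bar>L k (X \<omega>) + L k (Y \<omega>)\<bar> \<partial>M)" for k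
    proof (rule nn_integral_abs_diff_le_abs_sum_iid)
      show "indep_var borel (\<lambda>\<omega>. L k (X \<omega>)) borel (\<lambda>\<omega>. L k (Y \<omega>))"
        using indep_var_compose[OF indep L_meas L_meas] by (simp add: comp_def)
      show "distr M borel (\<lambda>\<omega>. L k (X \<omega>)) = distr M borel (\<lambda>\<omega>. L k (Y \<omega>))"
        using arg_cong[OF ident, of "\<lambda>N. distr N borel (L k)"]
        by (simp add: distr_distr[OF L_meas X] distr_distr[OF L_meas Y] comp_def)
    qed
    have L_diff: "L k (x - y) = L k x - L k y" and L_add: "L k (x + y) = L k x + L k y" for k x y
      using L[of k] by (simp_all add: linear_simps)
    have "?D \<le> (\<integral>\<^sup>+ \<omega>. (\<Sum>k<n. ennreal \<bar>L k (X \<omega>) - L k (Y \<omega>)\<bar>) \<partial>M)"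
      using lower by (intro nn_integral_mono) (simp add: L_diff[symmetric])
    also have "\<dots> = (\<Sum>k<n. \<integral>\<^sup>+ \<omega>. ennreal \<bar>L k (X \<omega>) - L k (Y \<omega>)\<bar> \<partial>M)"
      by (rule nn_integral_sum) simp
    also have "\<dots> \<le> (\<Sum>k<n. \<integral>\<^sup>+ \<omega>. ennreal \<bar>L k (X \<omega>) + L k (Y \<omega>)\<bar> \<partial>M)"
      by (intro sum_mono one_dim)
    also have "\<dots> = (\<integral>\<^sup>+ \<omega>. ennreal (\<Sum>k<n. \<bar>L k (X \<omega>) + L k (Y \<omega>)\<bar>) \<partial>M)"
      by (subst nn_integral_sum[symmetric]) simp_all
    \<comment> \<open>The factor \<open>1 + e\<close> is pulled out while the integrand is still a function of the real random
       variables \<open>L k (X \<omega>)\<close> and \<open>L k (Y \<omega>)\<close>, which makes its measurability immediate.\<close>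
    also have "\<dots> = (\<integral>\<^sup>+ \<omega>. ennreal (1 + e) * ennreal ((\<Sum>k<n. \<bar>L k (X \<omega>) + L k (Y \<omega>)\<bar>) / (1 + e)) \<partial>M)"
      using e by (intro nn_integral_cong) (subst ennreal_mult'[symmetric]; simp)
    also have "\<dots> = ennreal (1 + e) * (\<integral>\<^sup>+ \<omega>. ennreal ((\<Sum>k<n. \<bar>L k (X \<omega>) + L k (Y \<omega>)\<bar>) / (1 + e)) \<partial>M)"
      by (rule nn_integral_cmult) simp
    also have "\<dots> \<le> ennreal (1 + e) * ?S"
    proof (intro mult_left_mono nn_integral_mono ennreal_leI)
      fix \<omega>
      show "(\<Sum>k<n. \<bar>L k (X \<omega>) + L k (Y \<omega>)\<bar>) / (1 + e) \<le> norm (X \<omega> + Y \<omega>)"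
        using upper[of "X \<omega> + Y \<omega>"] e by (simp add: L_add field_simps)
    qed simp
    finally show ?thesis .
  qed
  show ?thesis
  proof (cases "?S = \<top>")
    case False
    have "((\<lambda>e. ennreal (1 + e) * ?S) \<longlongrightarrow> ennreal (1 + 0) * ?S) (at_right 0)"
      using False by (intro tendsto_intros tendsto_mult_ennreal) auto
    moreover have "\<forall>\<^sub>F e in at_right 0. ?D \<le> ennreal (1 + e) * ?S"
      using approx by (auto simp: eventually_at_filter)
    ultimately have "?D \<le> ennreal (1 + 0) * ?S"
      by (rule tendsto_lowerbound) simp
    then show ?thesis by simp
  qed simp
qed

end
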